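(* Let $(L,\cdot,\ast,\alpha,\beta)$ be a regular BiHom-Novikov-Poisson algebra over $K$. Define $$[x,y]=x\ast y-\alpha^{-1}\beta(y)\ast\alpha\beta^{-1}(x),\qquad x,y\in L.$$ Then $(L,\cdot,[,],\alpha,\beta)$ is a transposed BiHom-Poisson algebra.
   Context: $K$ is a field of characteristic $0$; all vector spaces and linear maps are over $K$. A BiHom-commutative algebra $(L,\cdot,\alpha,\beta)$ is a vector space $L$ with a bilinear product $\cdot$ and linear maps $\alpha,\beta:L\to L$ such that for all $x,y,z$: $\alpha\circ\beta=\beta\circ\alpha$, $\alpha(x\cdot y)=\alpha(x)\cdot\alpha(y)$, $\beta(x\cdot y)=\beta(x)\cdot\beta(y)$, $\alpha(x)\cdot(y\cdot z)=(x\cdot y)\cdot\beta(z)$, and $\beta(x)\cdot\alpha(y)=\beta(y)\cdot\alpha(x)$. A BiHom-Novikov algebra $(L,\ast,\alpha,\beta)$ is a vector space $L$ with a bilinear product $\ast$ and commuting linear maps $\alpha,\beta:L\to L$, multiplicative for $\ast$ (i.e. $\alpha(x\ast y)=\alpha(x)\ast\alpha(y)$, $\beta(x\ast y)=\beta(x)\ast\beta(y)$), such that for all $x,y,z$: $(\beta(x)\ast\alpha(y))\ast\beta(z)-\alpha\beta(x)\ast(\alpha(y)\ast z)=(\beta(y)\ast\alpha(x))\ast\beta(z)-\alpha\beta(y)\ast(\alpha(x)\ast z)$ and $(x\ast\beta(y))\ast\alpha\beta(z)=(x\ast\beta(z))\ast\alpha\beta(y)$. A BiHom-Novikov-Poisson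 algebra is a 5-tuple $(L,\cdot,\ast,\alpha,\beta)$ such that $(L,\cdot,\alpha,\beta)$ is a BiHom-commutative algebra, $(L,\ast,\alpha,\beta)$ is a BiHom-Novikov algebra, and for all $x,y,z$: $(\beta(x)\ast\alpha(y))\cdot\beta(z)-\alpha\beta(x)\ast(\alpha(y)\cdot z)=(\beta(y)\ast\alpha(x))\cdot\beta(z)-\alpha\beta(y)\ast(\alpha(x)\cdot z)$ and $(x\cdot\beta(y))\ast\alpha\beta(z)=(x\ast\beta(z))\cdot\alpha\beta(y)$. It is regular if $\alpha,\beta$ are invertible. A BiHom-Lie algebra $(L,[,],\alpha,\beta)$ is a vector space $L$ with a bilinear bracket and commuting linear maps $\alpha,\beta:L\to L$ such that for all $x,y,z$: $\alpha([x,y])=[\alpha(x),\alpha(y)]$, $\beta([x,y])=[\beta(x),\beta(y)]$, $[\beta(x),\alpha(y)]=-[\beta(y),\alpha(x)]$, and $[[\beta(x),\alpha(y)],\alpha^2(z)]+[[\beta(y),\alpha(z)],\alpha^2(x)]+[[\beta(z),\alpha(x)],\alpha^2(y)]=0$. A transposed BiHom-Poisson algebra is a 5-tuple $(L,\cdot,[,],\alpha,\beta)$ such that $(L,\cdot,\alpha,\beta)$ is a BiHom-commutative algebra, $(L,[,],\alpha,\beta)$ is a BiHom-Lie algebra, and for all $x,y,z$: $2\alpha\beta(x)\cdot[y,z]=[\beta(x)\cdot y,\beta(z)]+[\beta(y),\alpha(x)\cdot z]$. *)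

theory Defs
  imports Complex_Main
begin

definition bilinear_product ::
  "('k::field \<Rightarrow> 'a::ab_group_add \<Rightarrow> 'a) \<Rightarrow> ('a \<Rightarrow> 'a \<Rightarrow> 'a) \<Rightarrow> bool" where
  "bilinear_product s p \<longleftrightarrow>
     (\<forall>x. Vector_Spaces.linear s s (\<lambda>y. p x y)) \<and> (\<forall>y. Vector_Spaces.linear s s (\<lambda>x. p x y))"

locale bihom_algebra = vector_space scale
  for scale :: "'k::field_char_0 \<Rightarrow> 'a::ab_group_add \<Rightarrow> 'a" (infixr "*s" 75) +
  fixes prod :: "'a \<Rightarrow> 'a \<Rightarrow> 'a"
    and \<alpha> :: "'a \<Rightarrow> 'a"
    and \<beta> :: "'a \<Rightarrow> 'a"
  assumes bilinear: "bilinear_product scale prod"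
    and linear_\<alpha>: "Vector_Spaces.linear scale scale \<alpha>"
    and linear_\<beta>: "Vector_Spaces.linear scale scale \<beta>"
    and commute: "\<alpha> \<circ> \<beta> = \<beta> \<circ> \<alpha>"
    and mult_\<alpha>: "\<alpha> (prod x y) = prod (\<alpha> x) (\<alpha> y)"
    and mult_\<beta>: "\<beta> (prod x y) = prod (\<beta> x) (\<beta> y)"

locale bihom_commutative_algebra = bihom_algebra scale dot \<alpha> \<beta>
  for scale :: "'k::field_char_0 \<Rightarrow> 'a::ab_group_add \<Rightarrow> 'a" (infixr "*s" 75)
    and dot :: "'a \<Rightarrow> 'a \<Rightarrow> 'a" (infixl "\<cdot>" 70)
    and \<alpha> \<beta> +
  assumes bihom_assoc: "\<alpha> x \<cdot> (y \<cdot> z) = (x \<cdot> y) \<cdot> \<beta> z"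
    and bihom_comm: "\<beta> x \<cdot> \<alpha> y = \<beta> y \<cdot> \<alpha> x"

locale bihom_novikov_algebra = bihom_algebra scale star \<alpha> \<beta>
  for scale :: "'k::field_char_0 \<Rightarrow> 'a::ab_group_add \<Rightarrow> 'a" (infixr "*s" 75)
    and star :: "'a \<Rightarrow> 'a \<Rightarrow> 'a" (infixl "\<star>" 70)
    and \<alpha> \<beta> +
  assumes bihom_left_symmetric:
      "(\<beta> x \<star> \<alpha> y) \<star> \<beta> z - \<alpha> (\<beta> x) \<star> (\<alpha> y \<star> z) =
       (\<beta> y \<star> \<alpha> x) \<star> \<beta> z - \<alpha> (\<beta> y) \<star> (\<alpha> x \<star> z)"
    and bihom_right_comm:
      "(x \<star> \<beta> y) \<star> \<alpha> (\<beta> z) = (x \<star> \<beta> z) \<star> \<alpha> (\<beta> y)"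

locale bihom_novikov_poisson_algebra =
  bihom_commutative_algebra scale dot \<alpha> \<beta> + novikov: bihom_novikov_algebra scale star \<alpha> \<beta>
  for scale :: "'k::field_char_0 \<Rightarrow> 'a::ab_group_add \<Rightarrow> 'a" (infixr "*s" 75)
    and dot :: "'a \<Rightarrow> 'a \<Rightarrow> 'a" (infixl "\<cdot>" 70)
    and star :: "'a \<Rightarrow> 'a \<Rightarrow> 'a" (infixl "\<star>" 70)
    and \<alpha> \<beta> +
  assumes compat_left_symmetric:
      "(\<beta> x \<star> \<alpha> y) \<cdot> \<beta> z - \<alpha> (\<beta> x) \<star> (\<alpha> y \<cdot> z) =
       (\<beta> y \<star> \<alpha> x) \<cdot> \<beta> z - \<alpha> (\<beta> y) \<star> (\<alpha> x \<cdot> z)"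
    and compat_right_comm:
      "(x \<cdot> \<beta> y) \<star> \<alpha> (\<beta> z) = (x \<star> \<beta> z) \<cdot> \<alpha> (\<beta> y)"

locale regular_bihom_novikov_poisson_algebra =
  bihom_novikov_poisson_algebra scale dot star \<alpha> \<beta>
  for scale :: "'k::field_char_0 \<Rightarrow> 'a::ab_group_add \<Rightarrow> 'a" (infixr "*s" 75)
    and dot :: "'a \<Rightarrow> 'a \<Rightarrow> 'a" (infixl "\<cdot>" 70)
    and star :: "'a \<Rightarrow> 'a \<Rightarrow> 'a" (infixl "\<star>" 70)
    and \<alpha> \<beta> +
  assumes bij_\<alpha>: "bij \<alpha>"
    and bij_\<beta>: "bij \<beta>"

locale bihom_lie_algebra = bihom_algebra scale bracket \<alpha> \<beta>
  for scale :: "'k::field_char_0 \<Rightarrow> 'a::ab_group_add \<Rightarrow> 'a" (infixr "*s" 75)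
    and bracket :: "'a \<Rightarrow> 'a \<Rightarrow> 'a"
    and \<alpha> \<beta> +
  assumes bihom_skew: "bracket (\<beta> x) (\<alpha> y) = - bracket (\<beta> y) (\<alpha> x)"
    and bihom_jacobi:
      "bracket (bracket (\<beta> x) (\<alpha> y)) (\<alpha> (\<alpha> z)) +
       bracket (bracket (\<beta> y) (\<alpha> z)) (\<alpha> (\<alpha> x)) +
       bracket (bracket (\<beta> z) (\<alpha> x)) (\<alpha> (\<alpha> y)) = 0"

locale transposed_bihom_poisson_algebra =
  bihom_commutative_algebra scale dot \<alpha> \<beta> + lie: bihom_lie_algebra scale bracket \<alpha> \<beta>
  for scale :: "'k::field_char_0 \<Rightarrow> 'a::ab_group_add \<Rightarrow> 'a" (infixr "*s" 75)
    and dot :: "'a \<Rightarrow> 'a \<Rightarrow> 'a" (infixl "\<cdot>" 70)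
    and bracket :: "'a \<Rightarrow> 'a \<Rightarrow> 'a"
    and \<alpha> \<beta> +
  assumes transposed_leibniz:
      "2 *s (\<alpha> (\<beta> x) \<cdot> bracket y z) =
       bracket (\<beta> x \<cdot> y) (\<beta> z) + bracket (\<beta> y) (\<alpha> x \<cdot> z)"

end

theory Submission
  imports Defs
begin

text \<open>
  A regular BiHom structure is a twisted classical one. When \<open>\<alpha>\<close> and \<open>\<beta>\<close> are invertible, every
  BiHom product \<open>p\<close> has the form \<open>p x y = q (\<alpha> x) (\<beta> y)\<close>, where \<open>q\<close> is the untwisted product
  \<open>q x y = p (\<alpha>\<inverse> x) (\<beta>\<inverse> y)\<close>, for which \<open>\<alpha>\<close> and \<open>\<beta>\<close> are again multiplicative. Written
  in terms of \<open>q\<close>, each BiHom axiom becomes the corresponding classical axiom evaluated at arguments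
  of the form \<open>\<alpha>\<^sup>i \<beta>\<^sup>j x\<close>; since these arguments range over the whole space, the classical axiom
  holds for \<open>q\<close>. So a regular BiHom-Novikov-Poisson algebra untwists to an ordinary
  Novikov-Poisson algebra, and the bracket in question is the twist
  \<open>(x, y) \<mapsto> [\<alpha> x, \<beta> y]\<close> of the ordinary commutator of the untwisted Novikov product.

  It remains to treat the classical case, which is \<open>commutator_jacobi\<close> (left symmetry makes
  the commutator a Lie bracket) and \<open>commutator_transposed_leibniz\<close>, and to read the results
  at the twisted arguments.
\<close>

section \<open>Commutators in classical Novikov-Poisson algebras\<close>

text \<open>
  Expanding the Jacobi sum gives twelve triple products, which group into three differences of
  associators \<open>(x, y, z) - (y, x, z)\<close>; left symmetry says exactly that these vanish.
\<close>
lemma commutator_jacobi: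
  fixes star :: "'a::ab_group_add \<Rightarrow> 'a \<Rightarrow> 'a" (infixl "\<star>" 70)
  assumes diff_left: "\<And>x y z. (x - y) \<star> z = x \<star> z - y \<star> z"
    and diff_right: "\<And>x y z. x \<star> (y - z) = x \<star> y - x \<star> z"
    and left_symmetric: "\<And>x y z. (x \<star> y) \<star> z - x \<star> (y \<star> z) = (y \<star> x) \<star> z - y \<star> (x \<star> z)"
  defines "br \<equiv> \<lambda>x y. x \<star> y - y \<star> x"
  shows "br (br x y) z + br (br y z) x + br (br z x) y = 0"
proof -
  let ?as = "\<lambda>x y z. (x \<star> y) \<star> z - x \<star> (y \<star> z)"
  have "br (br x y) z + br (br y z) x + br (br z x) y =
      (?as x y z - ?as y x z) + (?as y z x - ?as z y x) + (?as z x y - ?as x z y)"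
    unfolding br_def diff_left diff_right by (simp add: algebra_simps)
  also have "\<dots> = 0"
    using left_symmetric by simp
  finally show ?thesis .
qed

text \<open>
  Right compatibility together with commutativity rewrites \<open>(x \<cdot> y) \<star> z\<close> as \<open>x \<cdot> (y \<star> z)\<close>, so two
  of the four terms on the right contribute one copy of \<open>x \<cdot> [y, z]\<close>. The other two,
  \<open>y \<star> (x \<cdot> z) - z \<star> (x \<cdot> y)\<close>, contribute the second copy by left compatibility.
\<close>
lemma commutator_transposed_leibniz:
  fixes dot :: "'a::ab_group_add \<Rightarrow> 'a \<Rightarrow> 'a" (infixl "\<cdot>" 70)
    and star :: "'a \<Rightarrow> 'a \<Rightarrow> 'a" (infixl "\<star>" 70)
  assumes diff_right: "\<And>x y z. x \<cdot> (y - z) = x \<cdot> y - x \<cdot> z"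
    and comm: "\<And>x y. x \<cdot> y = y \<cdot> x"
    and compat_left: "\<And>x y z. (x \<star> y) \<cdot> z - x \<star> (y \<cdot> z) = (y \<star> x) \<cdot> z - y \<star> (x \<cdot> z)"
    and compat_right: "\<And>x y z. (x \<cdot> y) \<star> z = (x \<star> z) \<cdot> y"
  defines "br \<equiv> \<lambda>x y. x \<star> y - y \<star> x"
  shows "x \<cdot> br y z + x \<cdot> br y z = br (x \<cdot> y) z + br y (x \<cdot> z)"
proof -
  have right: "(x \<cdot> u) \<star> v = x \<cdot> (u \<star> v)" for u v
    using comm compat_right by metis
  have left: "y \<star> (x \<cdot> z) - z \<star> (x \<cdot> y) = x \<cdot> (y \<star> z) - x \<cdot> (z \<star> y)"
    using compat_left[of y z x] by (simp add: comm algebra_simps)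
  show ?thesis
    using left unfolding br_def right diff_right by (simp add: algebra_simps)
qed

section \<open>Untwisting a regular BiHom product\<close>

lemma linear_inv:
  assumes lin: "Vector_Spaces.linear s s f" and bij: "bij f"
  shows "Vector_Spaces.linear s s (inv f)"
proof -
  have inv: "f (inv f x) = x" "inv f (f x) = x" for x
    using bij by (simp_all add: bij_is_inj bij_is_surj surj_f_inv_f)
  have "inv f (x + y) = inv f x + inv f y" for x y
    using lin unfolding Vector_Spaces.linear_iff by (metis inv)
  moreover have "inv f (s c x) = s c (inv f x)" for c x
    using lin unfolding Vector_Spaces.linear_iff by (metis inv)
  ultimately show ?thesis
    using lin unfolding Vector_Spaces.linear_iff by blast
qed

locale regular_bihom_algebra = bihom_algebra scale prod \<alpha> \<beta>
  for scale :: "'k::field_char_0 \<Rightarrow> 'a::ab_group_add \<Rightarrow> 'a" (infixr "*s" 75)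
    and prod \<alpha> \<beta> +
  assumes bijective_\<alpha>: "bij \<alpha>"
    and bijective_\<beta>: "bij \<beta>"
begin

definition untwist :: "'a \<Rightarrow> 'a \<Rightarrow> 'a" where
  "untwist x y = prod (inv \<alpha> x) (inv \<beta> y)"

lemma inv_simps [simp]:
  "\<alpha> (inv \<alpha> x) = x" "inv \<alpha> (\<alpha> x) = x" "\<beta> (inv \<beta> x) = x" "inv \<beta> (\<beta> x) = x"
  using bijective_\<alpha> bijective_\<beta>
  by (simp_all add: bij_is_inj bij_is_surj surj_f_inv_f)

lemma \<beta>_\<alpha>: "\<beta> (\<alpha> x) = \<alpha> (\<beta> x)"
  using commute by (metis comp_apply)

lemma inv_commute:
  "inv \<alpha> (\<beta> x) = \<beta> (inv \<alpha> x)" "inv \<beta> (\<alpha> x) = \<alpha> (inv \<beta> x)"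
  by (metis \<beta>_\<alpha> inv_simps)+

lemma linear_inv_\<alpha>: "Vector_Spaces.linear scale scale (inv \<alpha>)"
  using linear_inv[OF linear_\<alpha> bijective_\<alpha>] .

lemma linear_inv_\<beta>: "Vector_Spaces.linear scale scale (inv \<beta>)"
  using linear_inv[OF linear_\<beta> bijective_\<beta>] .

lemma \<alpha>_diff: "\<alpha> (x - y) = \<alpha> x - \<alpha> y"
  using linear_\<alpha> unfolding Vector_Spaces.linear_iff by (metis eq_diff_eq)

lemma \<beta>_diff: "\<beta> (x - y) = \<beta> x - \<beta> y"
  using linear_\<beta> unfolding Vector_Spaces.linear_iff by (metis eq_diff_eq)

lemma prod_eq_untwist: "prod x y = untwist (\<alpha> x) (\<beta> y)"
  by (simp add: untwist_def)

lemma \<alpha>_untwist: "\<alpha> (untwist x y) = untwist (\<alpha> x) (\<alpha> y)"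
  by (simp add: untwist_def mult_\<alpha> inv_commute)

lemma \<beta>_untwist: "\<beta> (untwist x y) = untwist (\<beta> x) (\<beta> y)"
  by (simp add: untwist_def mult_\<beta> inv_commute)

lemma untwist_add:
  "untwist x (y + z) = untwist x y + untwist x z"
  "untwist (x + y) z = untwist x z + untwist y z"
  using bilinear linear_inv_\<alpha> linear_inv_\<beta>
  by (simp_all add: untwist_def bilinear_product_def Vector_Spaces.linear_iff)

lemma untwist_scale:
  "untwist x (c *s y) = c *s untwist x y"
  "untwist (c *s x) y = c *s untwist x y"
  using bilinear linear_inv_\<alpha> linear_inv_\<beta>
  by (simp_all add: untwist_def bilinear_product_def Vector_Spaces.linear_iff)

lemma untwist_diff:
  "untwist x (y - z) = untwist x y - untwist x z"
  "untwist (x - y) z = untwist x z - untwist y z"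
  using untwist_add(1)[of x "y - z" z] untwist_add(2)[of "x - y" y z] by (simp_all add: eq_diff_eq)

end

section \<open>Regular BiHom-Novikov-Poisson algebras\<close>

context regular_bihom_novikov_poisson_algebra
begin

sublocale d: regular_bihom_algebra scale dot \<alpha> \<beta>
  by unfold_locales (rule bij_\<alpha> bij_\<beta>)+

sublocale s: regular_bihom_algebra scale star \<alpha> \<beta>
  by unfold_locales (rule bij_\<alpha> bij_\<beta>)+

abbreviation dot0 (infixl "\<odot>" 70) where "dot0 \<equiv> d.untwist"
abbreviation star0 (infixl "\<circledast>" 70) where "star0 \<equiv> s.untwist"

lemmas expand_twist =
  d.prod_eq_untwist s.prod_eq_untwist d.\<alpha>_untwist s.\<alpha>_untwist d.\<beta>_untwist s.\<beta>_untwist d.\<beta>_\<alpha>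

text \<open>
  After \<open>expand_twist\<close>, each variable of a BiHom axiom occurs only in the form \<open>\<alpha>\<^sup>i \<beta>\<^sup>j x\<close>, with
  the same exponents at every occurrence. Instantiating it with the preimage under \<open>\<alpha>\<^sup>i \<beta>\<^sup>j\<close>
  therefore cancels the twist and leaves the classical axiom; this is where bijectivity enters
  in the next four lemmas.
\<close>
lemma dot0_comm: "x \<odot> y = y \<odot> x"
  using bihom_comm[of "inv \<beta> (inv \<alpha> x)" "inv \<beta> (inv \<alpha> y)"]
  by (simp add: expand_twist)

lemma star0_left_symmetric:
  "(x \<circledast> y) \<circledast> z - x \<circledast> (y \<circledast> z) = (y \<circledast> x) \<circledast> z - y \<circledast> (x \<circledast> z)"
  using novikov.bihom_left_symmetric[of "inv \<beta> (inv \<alpha> (inv \<alpha> x))" "inv \<beta> (inv \<alpha> (inv \<alpha> y))"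
    "inv \<beta> (inv \<beta> z)"]
  by (simp add: expand_twist)

lemma untwisted_compat_left:
  "(x \<circledast> y) \<odot> z - x \<circledast> (y \<odot> z) = (y \<circledast> x) \<odot> z - y \<circledast> (x \<odot> z)"
  using compat_left_symmetric[of "inv \<beta> (inv \<alpha> (inv \<alpha> x))" "inv \<beta> (inv \<alpha> (inv \<alpha> y))"
    "inv \<beta> (inv \<beta> z)"]
  by (simp add: expand_twist)

lemma untwisted_compat_right: "(x \<odot> y) \<circledast> z = (x \<circledast> z) \<odot> y"
  using compat_right_comm[of "inv \<alpha> (inv \<alpha> x)" "inv \<beta> (inv \<beta> (inv \<alpha> y))"
    "inv \<beta> (inv \<beta> (inv \<alpha> z))"]
  by (simp add: expand_twist)

definition commutator0 :: "'a \<Rightarrow> 'a \<Rightarrow> 'a" where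
  "commutator0 x y = x \<circledast> y - y \<circledast> x"

definition bracket :: "'a \<Rightarrow> 'a \<Rightarrow> 'a" where
  "bracket x y = commutator0 (\<alpha> x) (\<beta> y)"

text \<open>
  The inverses in the second term are what the skew symmetry of the commutator requires: they
  cancel the twist that \<open>\<star>\<close> applies to the swapped pair, so that both terms are untwisted products
  of the same two elements \<open>\<alpha> x\<close> and \<open>\<beta> y\<close>.
\<close>
lemma bracket_eq: "x \<star> y - inv \<alpha> (\<beta> y) \<star> \<alpha> (inv \<beta> x) = bracket x y"
  by (simp add: bracket_def commutator0_def s.prod_eq_untwist d.\<beta>_\<alpha>)

lemma \<alpha>_commutator0: "\<alpha> (commutator0 x y) = commutator0 (\<alpha> x) (\<alpha> y)"
  by (simp add: commutator0_def d.\<alpha>_diff s.\<alpha>_untwist)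

lemma \<beta>_commutator0: "\<beta> (commutator0 x y) = commutator0 (\<beta> x) (\<beta> y)"
  by (simp add: commutator0_def d.\<beta>_diff s.\<beta>_untwist)

lemma commutator0_jacobi:
  "commutator0 (commutator0 x y) z + commutator0 (commutator0 y z) x
     + commutator0 (commutator0 z x) y = 0"
  unfolding commutator0_def
  by (rule commutator_jacobi[where star = star0, OF s.untwist_diff(2,1) star0_left_symmetric])

lemma commutator0_transposed_leibniz:
  "x \<odot> commutator0 y z + x \<odot> commutator0 y z
     = commutator0 (x \<odot> y) z + commutator0 y (x \<odot> z)"
  unfolding commutator0_def
  by (rule commutator_transposed_leibniz
      [where dot = dot0 and star = star0, OF d.untwist_diff(1) dot0_comm untwisted_compat_left untwisted_compat_right])

lemma bilinear_bracket: "bilinear_product scale bracket"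
  using linear_\<alpha> linear_\<beta>
  by (simp add: bilinear_product_def Vector_Spaces.linear_iff bracket_def commutator0_def
      s.untwist_add s.untwist_scale scale_right_diff_distrib)

text \<open>
  The skew symmetry, Jacobi and transposed Leibniz identities are the classical ones for
  \<open>commutator0\<close>, read at the arguments to which \<open>bracket\<close> and \<open>\<cdot>\<close> twist \<open>x\<close>, \<open>y\<close>, \<open>z\<close>.
\<close>
lemma transposed_bihom_poisson: "transposed_bihom_poisson_algebra scale dot bracket \<alpha> \<beta>"
proof (intro transposed_bihom_poisson_algebra.intro bihom_lie_algebra.intro bihom_algebra.intro
    bihom_algebra_axioms.intro bihom_lie_algebra_axioms.intro
    transposed_bihom_poisson_algebra_axioms.intro)
  fix x y z
  show "bihom_commutative_algebra scale dot \<alpha> \<beta>"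
    by (rule bihom_commutative_algebra_axioms)
  show "vector_space scale"
    by (rule vector_space_axioms)
  show "Vector_Spaces.linear scale scale \<alpha>" "Vector_Spaces.linear scale scale \<beta>"
    "\<alpha> \<circ> \<beta> = \<beta> \<circ> \<alpha>"
    by (rule linear_\<alpha> linear_\<beta> commute)+
  show "bilinear_product scale bracket"
    by (rule bilinear_bracket)
  show "\<alpha> (bracket x y) = bracket (\<alpha> x) (\<alpha> y)"
    by (simp add: bracket_def \<alpha>_commutator0 d.\<beta>_\<alpha>)
  show "\<beta> (bracket x y) = bracket (\<beta> x) (\<beta> y)"
    by (simp add: bracket_def \<beta>_commutator0 d.\<beta>_\<alpha>)
  show "bracket (\<beta> x) (\<alpha> y) = - bracket (\<beta> y) (\<alpha> x)"
    by (simp add: bracket_def commutator0_def d.\<beta>_\<alpha>)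
  show "bracket (bracket (\<beta> x) (\<alpha> y)) (\<alpha> (\<alpha> z)) +
       bracket (bracket (\<beta> y) (\<alpha> z)) (\<alpha> (\<alpha> x)) +
       bracket (bracket (\<beta> z) (\<alpha> x)) (\<alpha> (\<alpha> y)) = 0"
    using commutator0_jacobi[of "\<alpha> (\<alpha> (\<beta> x))" "\<alpha> (\<alpha> (\<beta> y))" "\<alpha> (\<alpha> (\<beta> z))"]
    by (simp add: bracket_def \<alpha>_commutator0 d.\<beta>_\<alpha>)
  show "2 *s (\<alpha> (\<beta> x) \<cdot> bracket y z) =
       bracket (\<beta> x \<cdot> y) (\<beta> z) + bracket (\<beta> y) (\<alpha> x \<cdot> z)"
  proof -
    have "2 *s v = v + v" for v
      using scale_left_distrib[of 1 1 v] by simp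
    then show ?thesis
      using commutator0_transposed_leibniz[of "\<alpha> (\<alpha> (\<beta> x))" "\<alpha> (\<beta> y)" "\<beta> (\<beta> z)"]
      by (simp add: bracket_def \<beta>_commutator0 expand_twist)
  qed
qed

end

theorem theorem2p14:
  fixes scale :: "'k::field_char_0 \<Rightarrow> 'a::ab_group_add \<Rightarrow> 'a"
    and dot star :: "'a \<Rightarrow> 'a \<Rightarrow> 'a"
    and \<alpha> \<beta> :: "'a \<Rightarrow> 'a"
  assumes "regular_bihom_novikov_poisson_algebra scale dot star \<alpha> \<beta>"
  shows "transposed_bihom_poisson_algebra scale dot
           (\<lambda>x y. star x y - star (inv \<alpha> (\<beta> y)) (\<alpha> (inv \<beta> x))) \<alpha> \<beta>"
proof -
  interpret regular_bihom_novikov_poisson_algebra scale dot star \<alpha> \<beta>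
    by (rule assms)
  show ?thesis
    unfolding bracket_eq by (rule transposed_bihom_poisson)
qed

end
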